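(* For $n\geq 3$ let $M_n$ be the diamond type lattice with $n$ elements, and let $\mathrm{IO}(M_n)$ be the set of all integral operators on $M_n$. (1) $|\mathrm{IO}(M_3)|=8$ and there are exactly $8$ isomorphism classes of integral operators on $M_3$. (2) $|\mathrm{IO}(M_4)|=14$ and there are exactly $9$ isomorphism classes of integral operators on $M_4$. (3) If $n\geq 5$, then $|\mathrm{IO}(M_n)|=2^{n-2}+3n-4$ and there are exactly $n+4$ isomorphism classes of integral operators on $M_n$.
   Context: For $n\geq 3$, $M_n=\{0,b_1,b_2,\ldots,b_{n-2},1\}$ is the $n$-element lattice with bottom element $0$, top element $1$, and $b_1,\ldots,b_{n-2}$ pairwise incomparable, so $b_i\wedge b_j=0$ and $b_i\vee b_j=1$ for $i\neq j$. Let $(L,\vee,\wedge)$ be a lattice. A map $P:L\to L$ is an integral operator if for all $x,y\in L$: (1) $P(x\vee y)=P(x)\vee P(y)$, and (2) $P(x)\wedge P(y)=P(P(x)\wedge y)\vee P(x\wedge P(y))$. Two integral operators $P,P'$ on $L$ are isomorphic if there is a lattice automorphism $f:L\to L$ with $f\circ P=P'\circ f$. This is an equivalence relation on the set of integral operators on $L$; its equivalence classes are the isomorphism classes of integral operators on $L$. *)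

theory Defs
  imports "HOL-Algebra.Lattice" "HOL-Library.FuncSet"
begin

datatype diamond = Bot | Atom nat | Top

fun diamond_le :: "diamond \<Rightarrow> diamond \<Rightarrow> bool" where
  "diamond_le Bot y = True"
| "diamond_le (Atom i) y = (y = Atom i \<or> y = Top)"
| "diamond_le Top y = (y = Top)"

text \<open>Only meaningful for \<open>n \<ge> 3\<close>; the element \<open>b\<^sub>i\<close> is \<open>Atom i\<close>.\<close>

definition M :: "nat \<Rightarrow> diamond gorder" where
  "M n = \<lparr>carrier = {Bot, Top} \<union> Atom ` {1..n - 2}, eq = (=), le = diamond_le\<rparr>"

text \<open>
  Self-maps of the carrier are represented by extensional functions (\<open>undefined\<close> outside the
  carrier), so that equality in HOL is equality of maps and counting such functions counts maps.
\<close>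

definition integral_operator :: "('a, 'b) gorder_scheme \<Rightarrow> ('a \<Rightarrow> 'a) \<Rightarrow> bool" where
  "integral_operator L P \<longleftrightarrow>
     P \<in> carrier L \<rightarrow>\<^sub>E carrier L \<and>
     (\<forall>x\<in>carrier L. \<forall>y\<in>carrier L.
        P (x \<squnion>\<^bsub>L\<^esub> y) = P x \<squnion>\<^bsub>L\<^esub> P y \<and>
        P x \<sqinter>\<^bsub>L\<^esub> P y = P (P x \<sqinter>\<^bsub>L\<^esub> y) \<squnion>\<^bsub>L\<^esub> P (x \<sqinter>\<^bsub>L\<^esub> P y))"

definition IO :: "('a, 'b) gorder_scheme \<Rightarrow> ('a \<Rightarrow> 'a) set" where
  "IO L = {P. integral_operator L P}"

definition lattice_automorphism :: "('a, 'b) gorder_scheme \<Rightarrow> ('a \<Rightarrow> 'a) \<Rightarrow> bool" where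
  "lattice_automorphism L f \<longleftrightarrow>
     bij_betw f (carrier L) (carrier L) \<and> join_pres L L f \<and> meet_pres L L f"

definition IO_iso :: "('a, 'b) gorder_scheme \<Rightarrow> (('a \<Rightarrow> 'a) \<times> ('a \<Rightarrow> 'a)) set" where
  "IO_iso L = {(P, P'). P \<in> IO L \<and> P' \<in> IO L \<and>
     (\<exists>f. lattice_automorphism L f \<and> (\<forall>x\<in>carrier L. f (P x) = P' (f x)))}"

definition IO_classes :: "('a, 'b) gorder_scheme \<Rightarrow> ('a \<Rightarrow> 'a) set set" where
  "IO_classes L = IO L // IO_iso L"

lemma equiv_IO_iso:
  assumes "lattice L"
  shows "equiv (IO L) (IO_iso L)"
proof -
  interpret lattice L by fact
  have IO_closed: "P x \<in> carrier L" if "P \<in> IO L" "x \<in> carrier L" for P x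
    using that by (auto simp: IO_def integral_operator_def)
  show ?thesis
  proof (rule equivI)
    show "IO_iso L \<subseteq> IO L \<times> IO L"
      by (auto simp: IO_iso_def)
    show "refl_on (IO L) (IO_iso L)"
    proof (rule refl_onI)
      fix P assume "P \<in> IO L"
      moreover have "lattice_automorphism L (\<lambda>x. x)"
        using assms by (simp add: lattice_automorphism_def join_pres_def meet_pres_def bij_betw_def)
      ultimately show "(P, P) \<in> IO_iso L"
        unfolding IO_iso_def by blast
    qed
    show "sym (IO_iso L)"
    proof (rule symI)
      fix P P' assume "(P, P') \<in> IO_iso L"
      then obtain f where P: "P \<in> IO L" "P' \<in> IO L" and f: "lattice_automorphism L f"
        and c: "\<And>x. x \<in> carrier L \<Longrightarrow> f (P x) = P' (f x)"
        by (auto simp: IO_iso_def)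
      define g where "g = the_inv_into (carrier L) f"
      have bij: "bij_betw f (carrier L) (carrier L)"
        using f by (simp add: lattice_automorphism_def)
      have inj: "inj_on f (carrier L)" and img: "f ` carrier L = carrier L"
        using bij by (auto simp: bij_betw_def)
      have gf: "g (f x) = x" if "x \<in> carrier L" for x
        unfolding g_def using inj that by (rule the_inv_into_f_f)
      have fg: "f (g y) = y" and gc: "g y \<in> carrier L" if "y \<in> carrier L" for y
        using that gf img by (metis imageE)+
      have "bij_betw g (carrier L) (carrier L)"
        unfolding g_def using bij by (rule bij_betw_the_inv_into)
      moreover have "g (x \<squnion>\<^bsub>L\<^esub> y) = g x \<squnion>\<^bsub>L\<^esub> g y" if "x \<in> carrier L" "y \<in> carrier L" for x y
        using f that fg gc gf[of "g x \<squnion>\<^bsub>L\<^esub> g y"]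
        by (simp add: lattice_automorphism_def join_pres_def)
      moreover have "g (x \<sqinter>\<^bsub>L\<^esub> y) = g x \<sqinter>\<^bsub>L\<^esub> g y" if "x \<in> carrier L" "y \<in> carrier L" for x y
        using f that fg gc gf[of "g x \<sqinter>\<^bsub>L\<^esub> g y"]
        by (simp add: lattice_automorphism_def meet_pres_def)
      ultimately have "lattice_automorphism L g"
        using assms by (simp add: lattice_automorphism_def join_pres_def meet_pres_def)
      moreover have "g (P' x) = P (g x)" if "x \<in> carrier L" for x
        using c[OF gc[OF that]] fg[OF that] gf IO_closed[OF P(1) gc[OF that]] by metis
      ultimately show "(P', P) \<in> IO_iso L"
        using P by (auto simp: IO_iso_def)
    qed
    show "trans (IO_iso L)"
    proof (rule transI)
      fix P Q R assume "(P, Q) \<in> IO_iso L" "(Q, R) \<in> IO_iso L"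
      then obtain f g where P: "P \<in> IO L" "R \<in> IO L"
        and f: "lattice_automorphism L f" and g: "lattice_automorphism L g"
        and c: "\<And>x. x \<in> carrier L \<Longrightarrow> f (P x) = Q (f x)"
          "\<And>x. x \<in> carrier L \<Longrightarrow> g (Q x) = R (g x)"
        by (auto simp: IO_iso_def)
      have fc: "f x \<in> carrier L" if "x \<in> carrier L" for x
        using f that by (auto simp: lattice_automorphism_def bij_betw_def)
      have "lattice_automorphism L (g \<circ> f)"
        using f g fc
        by (auto simp: lattice_automorphism_def join_pres_def meet_pres_def intro: bij_betw_trans)
      moreover have "\<forall>x\<in>carrier L. (g \<circ> f) (P x) = R ((g \<circ> f) x)"
        using c fc by simp
      ultimately show "(P, R) \<in> IO_iso L"
        using P unfolding IO_iso_def by blast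
    qed
  qed
qed

lemma least_M:
  assumes "x \<in> carrier (M n)" "y \<in> carrier (M n)"
  shows "least (M n) (if diamond_le x y then y else if diamond_le y x then x else Top)
    (Upper (M n) {x, y})"
  using assms by (cases x; cases y) (auto simp: least_def Upper_def M_def)

lemma greatest_M:
  assumes "x \<in> carrier (M n)" "y \<in> carrier (M n)"
  shows "greatest (M n) (if diamond_le x y then x else if diamond_le y x then y else Bot)
    (Lower (M n) {x, y})"
proof -
  have [simp]: "diamond_le z (Atom i) \<longleftrightarrow> z = Bot \<or> z = Atom i" "diamond_le z Top"
    "diamond_le z Bot \<longleftrightarrow> z = Bot" for z i
    by (cases z; auto)+
  show ?thesis
    using assms by (cases x; cases y) (auto simp: greatest_def Lower_def M_def)
qed

lemma lattice_M: "lattice (M n)"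
proof -
  interpret partial_order "M n"
  proof
    fix x y z assume "x \<in> carrier (M n)" "y \<in> carrier (M n)"
    show "x \<sqsubseteq>\<^bsub>M n\<^esub> y \<Longrightarrow> y \<sqsubseteq>\<^bsub>M n\<^esub> x \<Longrightarrow> x .=\<^bsub>M n\<^esub> y"
      by (cases x; cases y) (auto simp: M_def)
    show "x \<sqsubseteq>\<^bsub>M n\<^esub> y \<Longrightarrow> y \<sqsubseteq>\<^bsub>M n\<^esub> z \<Longrightarrow> x \<sqsubseteq>\<^bsub>M n\<^esub> z"
      by (cases x; cases y; cases z) (auto simp: M_def)
  next
    fix x show "x \<sqsubseteq>\<^bsub>M n\<^esub> x"
      by (cases x) (auto simp: M_def)
  qed (auto simp: M_def)
  show ?thesis
    by unfold_locales (rule exI, erule (1) least_M greatest_M)+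
qed

lemma join_M:
  assumes "x \<in> carrier (M n)" "y \<in> carrier (M n)"
  shows "x \<squnion>\<^bsub>M n\<^esub> y = (if diamond_le x y then y else if diamond_le y x then x else Top)"
proof -
  interpret lattice "M n" by (rule lattice_M)
  show ?thesis
    by (rule joinI[OF _ assms]) (erule least_unique[OF _ least_M[OF assms]])
qed

lemma meet_M:
  assumes "x \<in> carrier (M n)" "y \<in> carrier (M n)"
  shows "x \<sqinter>\<^bsub>M n\<^esub> y = (if diamond_le x y then x else if diamond_le y x then y else Bot)"
proof -
  interpret lattice "M n" by (rule lattice_M)
  show ?thesis
    by (rule meetI[OF _ assms]) (erule greatest_unique[OF _ greatest_M[OF assms]])
qed

lemma card_M:
  assumes "n \<ge> 3"
  shows "card (carrier (M n)) = n"
proof -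
  have "card (Atom ` {1..n - 2}) = n - 2"
    by (subst card_image) (auto simp: inj_on_def)
  moreover have "carrier (M n) = insert Bot (insert Top (Atom ` {1..n - 2}))"
    by (simp add: M_def)
  ultimately show ?thesis
    using assms by (auto simp: card_insert_if)
qed

end

theory Submission
  imports Defs "HOL-Combinatorics.Permutations"
begin

text \<open>
  Write \<open>A = {1..n - 2}\<close> for the set of atoms. An integral operator \<open>P\<close> on \<open>M n\<close> is monotone,
  so \<open>P Bot \<le> P Top\<close>, and these two values nearly determine it.

  \<^item> If \<open>P Bot = P Top\<close>, then \<open>P\<close> is constant. If \<open>P Bot\<close> is an atom and \<open>P Top = Top\<close>, the second axiom
    at \<open>Bot\<close> and \<open>Top\<close> shows that \<open>P\<close> fixes this atom, which forces all others to \<open>Top\<close>. In the remaining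
    cases \<open>P Bot = Bot\<close>.
  \<^item> The second axiom at \<open>x = y\<close> reads \<open>P x = P (P x \<sqinter> x)\<close>. If \<open>P Bot = Bot\<close>, an atom therefore cannot
    be sent to a different atom, for the meet would be \<open>Bot\<close>. So every atom goes to \<open>Bot\<close>, to itself,
    or to \<open>Top\<close>.
  \<^item> Two distinct atoms join to \<open>Top\<close>, so their values must join to \<open>P Top\<close>. With \<open>P Bot = Bot\<close> and
    \<open>P Top = Top\<close>, killing one atom, that is, sending it to \<open>Bot\<close>, forces all others to \<open>Top\<close>; if no
    atom is killed, the set of fixed atoms is arbitrary, which accounts for the \<open>2 ^ (n - 2)\<close> in the count.
  \<^item> If \<open>P Bot = Bot\<close> and \<open>P Top\<close> is an atom, all other atoms are killed, and there can be at most one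
    other atom. This family exists only for \<open>n \<le> 4\<close> and is the reason why \<open>M 3\<close> and \<open>M 4\<close> do not
    follow the general formula.

  Lemma \<open>integral_operator_is_op_of\<close> turns this into a list of shapes, each a constructor with an element,
  an atom or a set of atoms as parameter; lemma \<open>op_of_inj\<close> says that the list has no repetitions.

  The automorphisms of \<open>M n\<close> are the permutations of the atoms, and conjugating an operator by one of
  them just permutes the parameter of its shape (lemma \<open>IO_iso_op_of_iff\<close>). Two operators are thus
  isomorphic iff their shapes have the same constructor and parameters in the same orbit: the orbit of
  an atom is \<open>A\<close>, and that of a set of atoms consists of all sets of its cardinality. Choosing the
  atom \<open>1\<close> and the sets \<open>{1..k}\<close> as representatives, the isomorphism classes can be counted.
\<close>

section \<open>Join and meet in the diamond\<close>

definition djoin :: "diamond \<Rightarrow> diamond \<Rightarrow> diamond" where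
  "djoin x y = (if diamond_le x y then y else if diamond_le y x then x else Top)"

definition dmeet :: "diamond \<Rightarrow> diamond \<Rightarrow> diamond" where
  "dmeet x y = (if diamond_le x y then x else if diamond_le y x then y else Bot)"

lemma djoin_simps [simp]:
  "djoin Bot x = x" "djoin x Bot = x" "djoin Top x = Top" "djoin x Top = Top"
  "djoin x x = x" "djoin (Atom i) (Atom j) = (if i = j then Atom i else Top)"
  by (cases x; simp add: djoin_def)+

lemma dmeet_simps [simp]:
  "dmeet Bot x = Bot" "dmeet x Bot = Bot" "dmeet Top x = x" "dmeet x Top = x"
  "dmeet x x = x" "dmeet (Atom i) (Atom j) = (if i = j then Atom i else Bot)"
  by (cases x; simp add: dmeet_def)+

lemma djoin_commute: "djoin x y = djoin y x"
  by (cases x; cases y) auto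

lemma in_carrier_M [simp]:
  "Bot \<in> carrier (M n)" "Top \<in> carrier (M n)"
  "Atom i \<in> carrier (M n) \<longleftrightarrow> i \<in> {1..n - 2}"
  by (auto simp: M_def)

lemma carrier_M_cases:
  assumes "x \<in> carrier (M n)"
  obtains "x = Bot" | "x = Top" | i where "x = Atom i" "i \<in> {1..n - 2}"
  using assms by (auto simp: M_def)

lemma Atom_in_image [simp]: "Atom i \<in> Atom ` S \<longleftrightarrow> i \<in> S"
  by auto

lemma join_meet_M:
  assumes "x \<in> carrier (M n)" "y \<in> carrier (M n)"
  shows "x \<squnion>\<^bsub>M n\<^esub> y = djoin x y" "x \<sqinter>\<^bsub>M n\<^esub> y = dmeet x y"
  using assms by (simp_all add: join_M meet_M djoin_def dmeet_def)

lemma join_meet_closed: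
  assumes "x \<in> carrier (M n)" "y \<in> carrier (M n)"
  shows "djoin x y \<in> carrier (M n)" "dmeet x y \<in> carrier (M n)"
  using assms by (auto simp: djoin_def dmeet_def)

lemma integral_operator_M_iff:
  "integral_operator (M n) P \<longleftrightarrow> P \<in> carrier (M n) \<rightarrow>\<^sub>E carrier (M n) \<and>
     (\<forall>x\<in>carrier (M n). \<forall>y\<in>carrier (M n). P (djoin x y) = djoin (P x) (P y) \<and>
        dmeet (P x) (P y) = djoin (P (dmeet (P x) y)) (P (dmeet x (P y))))"
proof (cases "P \<in> carrier (M n) \<rightarrow>\<^sub>E carrier (M n)")
  case True
  then have "P x \<in> carrier (M n)" if "x \<in> carrier (M n)" for x
    using that by auto
  then show ?thesis
    unfolding integral_operator_def by (simp add: join_meet_M join_meet_closed)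
qed (simp add: integral_operator_def)

section \<open>The list of integral operators\<close>

text \<open>
  Each constructor stands for a family of integral operators, and its parameter records the data that an
  automorphism can move. The identity needs no family of its own: it is \<open>Fix S\<close> with \<open>S\<close> the set of
  all atoms.
\<close>

datatype shape = Const diamond | Kill nat | Lift nat | Fix "nat set" | Only nat

fun act :: "shape \<Rightarrow> diamond \<Rightarrow> diamond" where
  "act (Const c) x = c"
| "act (Kill i) x = (if x = Bot \<or> x = Atom i then Bot else Top)"
| "act (Lift i) x = (if x = Bot \<or> x = Atom i then Atom i else Top)"
| "act (Fix S) x = (if x = Bot \<or> x \<in> Atom ` S then x else Top)"
| "act (Only i) x = (if x = Top \<or> x = Atom i then Atom i else Bot)"

definition op_of :: "nat \<Rightarrow> shape \<Rightarrow> diamond \<Rightarrow> diamond" where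
  "op_of n c = restrict (act c) (carrier (M n))"

text \<open>
  \<open>Only i\<close> preserves joins only for \<open>n \<le> 4\<close>: two atoms other than \<open>i\<close> are both sent to \<open>Bot\<close>, whereas
  their join \<open>Top\<close> is sent to \<open>Atom i\<close>.
\<close>

definition shapes :: "nat \<Rightarrow> shape set" where
  "shapes n = Const ` carrier (M n) \<union> Kill ` {1..n - 2} \<union> Lift ` {1..n - 2} \<union>
     Fix ` Pow {1..n - 2} \<union> (if n \<le> 4 then Only ` {1..n - 2} else {})"

lemma in_shapes [simp]:
  "Const x \<in> shapes n \<longleftrightarrow> x \<in> carrier (M n)"
  "Kill i \<in> shapes n \<longleftrightarrow> i \<in> {1..n - 2}"
  "Lift i \<in> shapes n \<longleftrightarrow> i \<in> {1..n - 2}"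
  "Fix S \<in> shapes n \<longleftrightarrow> S \<subseteq> {1..n - 2}"
  "Only i \<in> shapes n \<longleftrightarrow> i \<in> {1..n - 2} \<and> n \<le> 4"
  by (auto simp: shapes_def)

lemma op_of_eqI:
  assumes "P \<in> carrier (M n) \<rightarrow>\<^sub>E carrier (M n)" "P Bot = act c Bot" "P Top = act c Top"
    "\<And>i. i \<in> {1..n - 2} \<Longrightarrow> P (Atom i) = act c (Atom i)"
  shows "P = op_of n c"
proof
  fix x
  show "P x = op_of n c x"
  proof (cases "x \<in> carrier (M n)")
    case True
    then show ?thesis using assms by (cases rule: carrier_M_cases) (auto simp: op_of_def)
  next
    case False
    then show ?thesis using assms(1) by (auto simp: op_of_def)
  qed
qed

lemma op_of_integral:
  assumes "c \<in> shapes n"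
  shows "integral_operator (M n) (op_of n c)"
proof -
  have closed: "act c x \<in> carrier (M n)" if "x \<in> carrier (M n)" for x
    using assms that by (cases c) auto
  have join: "act c (djoin x y) = djoin (act c x) (act c y)"
    if "x \<in> carrier (M n)" "y \<in> carrier (M n)" for x y
    using that assms
    by (elim carrier_M_cases; cases c) (auto split: if_splits)
  have meet: "dmeet (act c x) (act c y) = djoin (act c (dmeet (act c x) y)) (act c (dmeet x (act c y)))"
    if "x \<in> carrier (M n)" "y \<in> carrier (M n)" for x y
    using that assms
    by (elim carrier_M_cases; cases c)
      (auto split: if_splits)
  show ?thesis
    unfolding integral_operator_M_iff op_of_def
    using closed join meet by (auto simp: join_meet_closed)
qed

text \<open>
  The heart of the classification: a case distinction on \<open>P Bot\<close>, and then on \<open>P Top\<close>. The values at the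
  atoms follow from monotonicity (\<open>ge_bot\<close>, \<open>le_top\<close>), from \<open>P x = P (P x \<sqinter> x)\<close> (\<open>own\<close>), and from the
  fact that two atoms join to \<open>Top\<close> (\<open>two_atoms\<close>).
\<close>

lemma integral_operator_is_op_of:
  assumes "integral_operator (M n) P"
  shows "\<exists>c\<in>shapes n. P = op_of n c"
proof -
  let ?L = "carrier (M n)" and ?A = "{1..n - 2}"
  have P: "P \<in> ?L \<rightarrow>\<^sub>E ?L"
    and join: "\<And>x y. x \<in> ?L \<Longrightarrow> y \<in> ?L \<Longrightarrow> P (djoin x y) = djoin (P x) (P y)"
    and meet: "\<And>x y. x \<in> ?L \<Longrightarrow> y \<in> ?L \<Longrightarrow>
      dmeet (P x) (P y) = djoin (P (dmeet (P x) y)) (P (dmeet x (P y)))"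
    using assms unfolding integral_operator_M_iff by auto
  have PL: "P x \<in> ?L" if "x \<in> ?L" for x using P that by auto
  have ge_bot: "djoin (P Bot) (P x) = P x" if "x \<in> ?L" for x
    using join[of Bot x] that by simp
  have le_top: "djoin (P x) (P Top) = P Top" if "x \<in> ?L" for x
    using join[of x Top] that by simp
  have two_atoms: "djoin (P (Atom i)) (P (Atom j)) = P Top" if "i \<in> ?A" "j \<in> ?A" "i \<noteq> j" for i j
    using join[of "Atom i" "Atom j"] that by simp
  have own: "P (Atom j) \<in> {Bot, Atom j, Top}" if "P Bot = Bot" "j \<in> ?A" for j
    using PL[of "Atom j"] meet[of "Atom j" "Atom j"] that
    by (cases "P (Atom j)") (auto split: if_splits)
  from PL[OF in_carrier_M(1)] show ?thesis
  proof (cases rule: carrier_M_cases)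
    case 2
    then have "P = op_of n (Const Top)"
      using ge_bot P by (intro op_of_eqI) fastforce+
    then show ?thesis by auto
  next
    case (3 i)
    from PL[OF in_carrier_M(2)] show ?thesis
    proof (cases rule: carrier_M_cases)
      case 1
      then show ?thesis using 3 le_top[of Bot] by simp
    next
      case 2
      have i: "P (Atom i) = Atom i"
        using meet[of Bot Top] ge_bot[of "Atom i"] 3 2 djoin_commute[of "Atom i"] by simp
      have "P (Atom j) = Top" if "j \<in> ?A" "j \<noteq> i" for j
        using two_atoms[of i j] ge_bot[of "Atom j"] that 3 2 i by simp
      then have "P = op_of n (Lift i)"
        using 3 2 i P by (intro op_of_eqI) auto
      then show ?thesis using 3 by auto
    next
      case (3 k)
      have k: "k = i"
        using 3 \<open>P Bot = Atom i\<close> le_top[of Bot] by (simp split: if_splits)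
      have "P (Atom j) = Atom i" if "j \<in> ?A" for j
        using le_top[of "Atom j"] ge_bot[of "Atom j"] that 3 k \<open>P Bot = Atom i\<close>
        by (cases "P (Atom j)") (auto split: if_splits)
      then have "P = op_of n (Const (Atom i))"
        using 3 k \<open>P Bot = Atom i\<close> P by (intro op_of_eqI) auto
      then show ?thesis using 3 k by auto
    qed
  next
    case bot: 1
    from PL[OF in_carrier_M(2)] show ?thesis
    proof (cases rule: carrier_M_cases)
      case 1
      have "P (Atom j) = Bot" if "j \<in> ?A" for j
        using le_top[of "Atom j"] that 1 by simp
      then have "P = op_of n (Const Bot)"
        using bot 1 P by (intro op_of_eqI) auto
      then show ?thesis by auto
    next
      case top: 2
      show ?thesis
      proof (cases "\<exists>i\<in>?A. P (Atom i) = Bot")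
        case True
        then obtain i where i: "i \<in> ?A" "P (Atom i) = Bot" by blast
        have "P (Atom j) = Top" if "j \<in> ?A" "j \<noteq> i" for j
          using two_atoms[of i j] that i top by simp
        then have "P = op_of n (Kill i)"
          using bot top i P by (intro op_of_eqI) auto
        then show ?thesis using i by auto
      next
        case False
        let ?S = "{i \<in> ?A. P (Atom i) = Atom i}"
        have "P = op_of n (Fix ?S)"
          using bot top own False P by (intro op_of_eqI) auto
        then show ?thesis by (rule bexI) (simp only: in_shapes, blast)
      qed
    next
      case top: (3 i)
      have i: "P (Atom i) = Atom i"
      proof -
        have "P Top = P (P Top)"
          using meet[of Top Top] by simp
        then show ?thesis unfolding top ..
      qed
      have other: "P (Atom j) = Bot" if "j \<in> ?A" "j \<noteq> i" for j
        using le_top[of "Atom j"] own[OF bot that(1)] that top by auto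
      \<comment> \<open>Otherwise there are two atoms besides \<open>i\<close>, chosen here among 1, 2, 3;
        both are killed, but their join is not.\<close>
      have "n \<le> 4"
      proof (rule ccontr)
        assume "\<not> n \<le> 4"
        then have "\<exists>j k. j \<in> ?A - {i} \<and> k \<in> ?A - {i} \<and> j \<noteq> k"
          by (intro exI[of _ "if i = 1 then 2 else 1"] exI[of _ "if i = 3 then 2 else 3"]) auto
        then obtain j k where "j \<in> ?A - {i}" "k \<in> ?A - {i}" "j \<noteq> k" by blast
        then show False
          using two_atoms[of j k] other top by simp
      qed
      moreover have "P = op_of n (Only i)"
        using bot top i other P by (intro op_of_eqI) auto
      ultimately show ?thesis using top by auto
    qed
  qed
qed

text \<open>
  The values at \<open>Bot\<close> and \<open>Top\<close> separate the shapes, except that they are \<open>Bot\<close> and \<open>Top\<close> for all shapes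
  \<open>Kill i\<close> and \<open>Fix S\<close>. Among these the values at the atoms decide: a killed atom is visible because
  \<open>Fix S\<close> sends no atom to \<open>Bot\<close>.
\<close>

lemma op_of_inj: "inj_on (op_of n) (shapes n)"
proof (rule inj_onI)
  fix c d assume cd: "c \<in> shapes n" "d \<in> shapes n" and eq: "op_of n c = op_of n d"
  have eq: "act c x = act d x" if "x \<in> carrier (M n)" for x
    using fun_cong[OF eq, of x] that by (simp add: op_of_def)
  have A: "act c (Atom i) = act d (Atom i)" if "i \<in> {1..n - 2}" for i
    using that by (intro eq) simp
  have kill: "i = j" if "c = Kill i" "d = Kill j" for i j
    using A[of i] cd that by (auto split: if_splits)
  have kill_fix: "c \<noteq> Kill i \<or> d \<noteq> Fix S" "c \<noteq> Fix S \<or> d \<noteq> Kill i" for i S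
    using A[of i] cd by (auto split: if_splits)
  have fix_fix: "S = T" if "c = Fix S" "d = Fix T" for S T
  proof -
    have "i \<in> S \<longleftrightarrow> i \<in> T" if "i \<in> {1..n - 2}" for i
      using A[OF that] \<open>c = _\<close> \<open>d = _\<close> by (auto split: if_splits)
    moreover have "S \<subseteq> {1..n - 2}" "T \<subseteq> {1..n - 2}"
      using that cd by (auto split: if_splits)
    ultimately show ?thesis by blast
  qed
  have ends: "act c Bot = act d Bot" "act c Top = act d Top"
    by (simp_all add: eq)
  show "c = d"
  proof (cases c)
    case c: (Kill i)
    show ?thesis
    proof (cases d)
      case (Kill j)
      then show ?thesis using c kill by blast
    next
      case (Fix T)
      then show ?thesis using c kill_fix by blast
    qed (use c ends in auto)
  next
    case c: (Fix S)
    show ?thesis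
    proof (cases d)
      case (Kill j)
      then show ?thesis using c kill_fix by blast
    next
      case (Fix T)
      then show ?thesis using c fix_fix by blast
    qed (use c ends in auto)
  qed (use ends in \<open>cases d; auto\<close>)+
qed

lemma IO_M_eq: "IO (M n) = op_of n ` shapes n"
  using op_of_integral integral_operator_is_op_of unfolding IO_def by blast

lemma images_disjoint:
  assumes "\<And>x y. x \<in> A \<Longrightarrow> y \<in> B \<Longrightarrow> f x \<noteq> g y"
  shows "f ` A \<inter> g ` B = {}"
  using assms by blast

lemma card_shapes:
  assumes "n \<ge> 3"
  shows "card (shapes n) = 2 ^ (n - 2) + 3 * n - 4 + (if n \<le> 4 then n - 2 else 0)"
proof -
  let ?A = "{1..n - 2}"
  have fin: "finite (carrier (M n))" by (simp add: M_def)
  obtain m where m: "n = m + 2" using that[of "n - 2"] assms by simp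
  have "card (Const ` carrier (M n)) = n" "card (Kill ` ?A) = n - 2" "card (Lift ` ?A) = n - 2"
    "card (Fix ` Pow ?A) = 2 ^ (n - 2)" "card (Only ` ?A) = n - 2"
    by (simp_all add: card_image inj_on_def card_M[OF assms] card_Pow)
  then show ?thesis
    using fin m by (auto simp: shapes_def card_Un_disjoint images_disjoint Int_Un_distrib2)
qed

section \<open>Automorphisms as permutations of the atoms\<close>

fun relabel :: "(nat \<Rightarrow> nat) \<Rightarrow> diamond \<Rightarrow> diamond" where
  "relabel p Bot = Bot"
| "relabel p (Atom i) = Atom (p i)"
| "relabel p Top = Top"

fun rename :: "(nat \<Rightarrow> nat) \<Rightarrow> shape \<Rightarrow> shape" where
  "rename p (Const c) = Const (relabel p c)"
| "rename p (Kill i) = Kill (p i)"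
| "rename p (Lift i) = Lift (p i)"
| "rename p (Fix S) = Fix (p ` S)"
| "rename p (Only i) = Only (p i)"

text \<open>
  The five families are defined without reference to particular atoms, so relabelling the atoms of an
  operator amounts to relabelling its parameter.
\<close>

lemma act_rename:
  assumes "inj p"
  shows "act (rename p c) (relabel p x) = relabel p (act c x)"
  using assms by (cases c; cases x) (auto simp: inj_eq inj_image_mem_iff)

lemma relabel_carrier:
  assumes "p permutes {1..n - 2}" "x \<in> carrier (M n)"
  shows "relabel p x \<in> carrier (M n)"
  using assms(2) permutes_in_image[OF assms(1)] by (cases rule: carrier_M_cases) auto

lemma rename_shapes:
  assumes "p permutes {1..n - 2}" "c \<in> shapes n"
  shows "rename p c \<in> shapes n"
  using assms(2) permutes_in_image[OF assms(1)] relabel_carrier[OF assms(1)]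
  by (cases c) auto

lemma relabel_comp: "relabel p (relabel q x) = relabel (p \<circ> q) x"
  by (cases x) auto

lemma relabel_id: "relabel id x = x"
  by (cases x) auto

lemma relabel_automorphism:
  assumes p: "p permutes {1..n - 2}"
  shows "lattice_automorphism (M n) (relabel p)"
proof -
  have inj: "inj p" using p by (rule permutes_inj)
  have "bij_betw (relabel p) (carrier (M n)) (carrier (M n))"
    by (rule bij_betw_byWitness[of _ "relabel (inv p)"])
      (use relabel_carrier[OF p] relabel_carrier[OF permutes_inv[OF p]] in
        \<open>auto simp: relabel_comp permutes_inv_o[OF p] relabel_id\<close>)
  moreover have "diamond_le (relabel p x) (relabel p y) = diamond_le x y" for x y
    using inj by (cases x; cases y) (auto simp: inj_eq)
  ultimately show ?thesis
    unfolding lattice_automorphism_def join_pres_def meet_pres_def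
    using lattice_M relabel_carrier[OF p] by (auto simp: join_M meet_M)
qed

text \<open>
  A surjective lattice homomorphism preserves \<open>Bot\<close> and \<open>Top\<close>, hence a bijective one permutes the
  remaining elements, which are the atoms.
\<close>

lemma automorphism_is_relabel:
  assumes "lattice_automorphism (M n) f"
  shows "\<exists>p. p permutes {1..n - 2} \<and> (\<forall>x\<in>carrier (M n). f x = relabel p x)"
proof -
  let ?L = "carrier (M n)" and ?A = "{1..n - 2}"
  have inj: "inj_on f ?L" and img: "f ` ?L = ?L"
    using assms by (simp_all add: lattice_automorphism_def bij_betw_def)
  then have closed: "f x \<in> ?L" if "x \<in> ?L" for x
    using that by blast
  have join: "f (djoin x y) = djoin (f x) (f y)" and meet: "f (dmeet x y) = dmeet (f x) (f y)"
    if "x \<in> ?L" "y \<in> ?L" for x y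
    using assms that closed
    by (simp_all add: lattice_automorphism_def join_pres_def meet_pres_def join_meet_M)
  obtain y where "y \<in> ?L" "f y = Bot" using img in_carrier_M(1) by (metis imageE)
  then have bot: "f Bot = Bot" using meet[of Bot y] by simp
  obtain z where "z \<in> ?L" "f z = Top" using img in_carrier_M(2) by (metis imageE)
  then have top: "f Top = Top" using join[of Top z] by simp
  have "\<exists>j\<in>?A. f (Atom i) = Atom j" if "i \<in> ?A" for i
  proof -
    have "f (Atom i) \<in> ?L" using that img by auto
    moreover have "f (Atom i) \<noteq> f Bot" "f (Atom i) \<noteq> f Top"
      using that inj by (auto simp: inj_on_eq_iff)
    ultimately show ?thesis using bot top by (auto elim: carrier_M_cases)
  qed
  then obtain g where g: "\<And>i. i \<in> ?A \<Longrightarrow> g i \<in> ?A \<and> f (Atom i) = Atom (g i)" by metis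
  \<comment> \<open>A permutation in the sense of \<open>permutes\<close> is the identity outside \<open>?A\<close>.\<close>
  define p where "p i = (if i \<in> ?A then g i else i)" for i
  have "inj_on p ?A"
  proof (rule inj_onI)
    fix i j assume ij: "i \<in> ?A" "j \<in> ?A" "p i = p j"
    then have "f (Atom i) = f (Atom j)" using g by (simp add: p_def)
    then show "i = j" using ij inj by (simp add: inj_on_eq_iff)
  qed
  moreover have "p ` ?A \<subseteq> ?A" using g by (auto simp: p_def)
  ultimately have "bij_betw p ?A ?A"
    by (simp add: bij_betw_def endo_inj_surj)
  then have "p permutes ?A" by (rule bij_imp_permutes) (simp only: p_def if_False)
  moreover have "f x = relabel p x" if "x \<in> ?L" for x
    using that g bot top by (cases rule: carrier_M_cases) (auto simp: p_def)
  ultimately show ?thesis by blast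
qed

text \<open>
  The operator isomorphic to \<open>op_of n c\<close> via \<open>relabel p\<close> is \<open>op_of n (rename p c)\<close> by lemma
  \<open>act_rename\<close>, and since shapes are determined by their operators, it has no other shape.
\<close>

lemma IO_iso_op_of_iff:
  assumes c: "c \<in> shapes n" and d: "d \<in> shapes n"
  shows "(op_of n c, op_of n d) \<in> IO_iso (M n) \<longleftrightarrow> (\<exists>p. p permutes {1..n - 2} \<and> d = rename p c)"
proof -
  let ?L = "carrier (M n)"
  have closed: "act e x \<in> ?L" if "e \<in> shapes n" "x \<in> ?L" for e x
    using op_of_integral[OF that(1)] that(2) by (auto simp: integral_operator_def op_of_def)
  have conj: "(\<forall>x\<in>?L. relabel p (op_of n c x) = op_of n d (relabel p x)) \<longleftrightarrow> d = rename p c"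
    if p: "p permutes {1..n - 2}" for p
  proof
    assume *: "\<forall>x\<in>?L. relabel p (op_of n c x) = op_of n d (relabel p x)"
    have "op_of n (rename p c) y = op_of n d y" for y
    proof (cases "y \<in> ?L")
      case True
      then obtain x where x: "x \<in> ?L" "y = relabel p x"
        using relabel_automorphism[OF p] by (auto simp: lattice_automorphism_def bij_betw_def)
      have "op_of n (rename p c) y = relabel p (op_of n c x)"
        using x True act_rename[OF permutes_inj[OF p]] by (simp add: op_of_def)
      then show ?thesis using * x by simp
    qed (simp add: op_of_def)
    then show "d = rename p c"
      using op_of_inj d rename_shapes[OF p c] by (metis ext inj_onD)
  next
    assume "d = rename p c"
    then show "\<forall>x\<in>?L. relabel p (op_of n c x) = op_of n d (relabel p x)"
      using act_rename[OF permutes_inj[OF p]] relabel_carrier[OF p] by (simp add: op_of_def)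
  qed
  have opL: "op_of n c x \<in> ?L" if "x \<in> ?L" for x
    using closed[OF c that] that by (simp add: op_of_def)
  have "op_of n c \<in> IO (M n)" "op_of n d \<in> IO (M n)"
    using c d by (auto simp: IO_M_eq)
  then have "(op_of n c, op_of n d) \<in> IO_iso (M n) \<longleftrightarrow>
      (\<exists>f. lattice_automorphism (M n) f \<and> (\<forall>x\<in>?L. f (op_of n c x) = op_of n d (f x)))"
    by (simp add: IO_iso_def)
  also have "\<dots> \<longleftrightarrow> (\<exists>p. p permutes {1..n - 2} \<and>
      (\<forall>x\<in>?L. relabel p (op_of n c x) = op_of n d (relabel p x)))"
    (is "?l \<longleftrightarrow> ?r")
  proof
    assume ?l
    then obtain f where f: "lattice_automorphism (M n) f"
      "\<And>x. x \<in> ?L \<Longrightarrow> f (op_of n c x) = op_of n d (f x)" by blast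
    then obtain p where "p permutes {1..n - 2}" "\<And>x. x \<in> ?L \<Longrightarrow> f x = relabel p x"
      using automorphism_is_relabel by blast
    then show ?r using f opL by (intro exI[of _ p]) auto
  next
    assume ?r
    then show ?l using relabel_automorphism by blast
  qed
  also have "\<dots> \<longleftrightarrow> (\<exists>p. p permutes {1..n - 2} \<and> d = rename p c)"
    using conj by blast
  finally show ?thesis .
qed

section \<open>Orbits of shapes\<close>

text \<open>
  The symmetric group on a finite set acts transitively on the subsets of each size: a bijection
  between two such subsets is completed by any bijection between their complements.
\<close>

lemma permutes_onto_subset:
  assumes "finite A" "S \<subseteq> A" "T \<subseteq> A" "card S = card T"
  shows "\<exists>p. p permutes A \<and> p ` S = T"
proof -
  have fin: "finite S" "finite T" using assms finite_subset by auto
  obtain f where f: "bij_betw f S T"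
    using finite_same_card_bij[OF fin assms(4)] by blast
  have "card (A - S) = card (A - T)"
    using assms fin by (simp add: card_Diff_subset)
  then obtain g where g: "bij_betw g (A - S) (A - T)"
    using finite_same_card_bij assms(1) by (metis finite_Diff)
  define p where "p x = (if x \<in> S then f x else if x \<in> A then g x else x)" for x
  have pS: "bij_betw p S T" using f by (rule bij_betw_cong[THEN iffD1, rotated]) (simp add: p_def)
  have "bij_betw p (A - S) (A - T)"
    using g by (rule bij_betw_cong[THEN iffD1, rotated]) (simp add: p_def)
  with pS have "bij_betw p (S \<union> (A - S)) (T \<union> (A - T))"
    by (rule bij_betw_combine) auto
  then have "bij_betw p A A" using assms by (simp add: Un_absorb1)
  then have "p permutes A" by (rule bij_imp_permutes) (use assms in \<open>auto simp: p_def\<close>)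
  then show ?thesis using pS by (auto simp: bij_betw_def)
qed

text \<open>
  A representative of the orbit of a shape under \<open>rename\<close>. The constant relabelling leaves \<open>Bot\<close> and \<open>Top\<close>
  alone and sends each atom to \<open>Atom 1\<close>.
\<close>

fun canon :: "shape \<Rightarrow> shape" where
  "canon (Const c) = Const (relabel (\<lambda>_. 1) c)"
| "canon (Kill i) = Kill 1"
| "canon (Lift i) = Lift 1"
| "canon (Fix S) = Fix {1..card S}"
| "canon (Only i) = Only 1"

lemma canon_rename:
  assumes "inj p"
  shows "canon (rename p c) = canon c"
proof -
  have "card (p ` S) = card S" for S
    using assms by (simp add: card_image inj_on_subset)
  then show ?thesis by (cases c) (simp_all add: relabel_comp comp_def)
qed

lemma canon_orbit:
  assumes c: "c \<in> shapes n"
  shows "\<exists>p. p permutes {1..n - 2} \<and> canon c = rename p c"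
proof -
  have move: "\<exists>p. p permutes {1..n - 2} \<and> p i = 1" if "i \<in> {1..n - 2}" for i
    using permutes_onto_subset[of "{1..n - 2}" "{i}" "{1}"] that by auto
  have sub: "\<exists>p. p permutes {1..n - 2} \<and> p ` S = {1..card S}" if "S \<subseteq> {1..n - 2}" for S
    using permutes_onto_subset[of "{1..n - 2}" S "{1..card S}"] that card_mono[OF _ that] by simp
  show ?thesis
  proof (cases c)
    case (Const x)
    then have "x \<in> carrier (M n)" using c by simp
    then show ?thesis
    proof (cases rule: carrier_M_cases)
      case (3 i)
      then show ?thesis using move[of i] Const by auto
    qed (use Const in \<open>auto intro!: exI[of _ id]\<close>)
  next
    case (Fix S)
    then have "S \<subseteq> {1..n - 2}" using c by simp
    then show ?thesis using sub[of S] Fix by auto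
  next
    case (Kill i)
    then show ?thesis using c move[of i] by auto
  next
    case (Lift i)
    then show ?thesis using c move[of i] by auto
  next
    case (Only i)
    then show ?thesis using c move[of i] by auto
  qed
qed

lemma IO_iso_op_of_iff_canon:
  assumes c: "c \<in> shapes n" and d: "d \<in> shapes n"
  shows "(op_of n c, op_of n d) \<in> IO_iso (M n) \<longleftrightarrow> canon c = canon d"
proof
  assume "(op_of n c, op_of n d) \<in> IO_iso (M n)"
  then show "canon c = canon d"
    unfolding IO_iso_op_of_iff[OF assms] using canon_rename permutes_inj by metis
next
  assume eq: "canon c = canon d"
  note equiv = equiv_IO_iso[OF lattice_M[of n]]
  have rep: "(op_of n e, op_of n (canon e)) \<in> IO_iso (M n)" if e: "e \<in> shapes n" for e
    using canon_orbit[OF e] IO_iso_op_of_iff[OF e] rename_shapes[OF _ e] by metis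
  show "(op_of n c, op_of n d) \<in> IO_iso (M n)"
    using rep[OF c] rep[OF d] eq equiv by (metis equivE symD transD)
qed

section \<open>Counting\<close>

text \<open>
  Two maps with the same fibres on \<open>A\<close> have equally large images. Here one sends a shape to the isomorphism
  class of its operator and the other to its canonical shape.
\<close>

lemma card_image_eq_card_image:
  assumes "\<And>x y. x \<in> A \<Longrightarrow> y \<in> A \<Longrightarrow> f x = f y \<longleftrightarrow> g x = g y"
  shows "card (f ` A) = card (g ` A)"
proof -
  let ?h = "\<lambda>b. f (inv_into A g b)"
  have *: "?h (g x) = f x" if "x \<in> A" for x
    using assms[of "inv_into A g (g x)" x] that by (simp add: inv_into_into f_inv_into_f)
  have "inj_on ?h (g ` A)"
    using assms * by (auto simp: inj_on_def)
  moreover have "?h ` g ` A = f ` A"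
    using * by (force simp: image_iff)
  ultimately show ?thesis by (metis card_image)
qed

lemma card_canon_shapes:
  assumes "n \<ge> 3"
  shows "card (canon ` shapes n) = n + 4 + (if n \<le> 4 then 1 else 0)"
proof -
  let ?A = "{1..n - 2}"
  have ne: "1 \<in> ?A" using assms by simp
  have const: "(\<lambda>i. k) ` ?A = {k}" for k :: shape using ne by blast
  have "card ` Pow ?A = {0..n - 2}"
  proof
    show "{0..n - 2} \<subseteq> card ` Pow ?A"
    proof
      fix k assume "k \<in> {0..n - 2}"
      then show "k \<in> card ` Pow ?A" by (intro image_eqI[of _ _ "{1..k}"]) auto
    qed
  qed (use card_mono[of ?A] in \<open>fastforce\<close>)
  then have fix_image: "(\<lambda>S. Fix {1..card S}) ` Pow ?A = (\<lambda>k. Fix {1..k}) ` {0..n - 2}"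
    by (metis (no_types, lifting) image_image image_cong)
  have car: "(\<lambda>c. Const (relabel (\<lambda>_. 1) c)) ` carrier (M n) = {Const Bot, Const Top, Const (Atom 1)}"
    using const[of "Const (Atom 1)"] by (simp add: M_def image_Un image_image)
  have "canon ` shapes n = {Const Bot, Const Top, Const (Atom 1), Kill 1, Lift 1} \<union>
    (\<lambda>k. Fix {1..k}) ` {0..n - 2} \<union> (if n \<le> 4 then {Only 1} else {})"
    by (cases "n \<le> 4", simp_all only: shapes_def if_True if_False image_Un image_image
      canon.simps car const fix_image, auto)
  moreover have "card ((\<lambda>k. Fix {1..k}) ` {0..n - 2}) = n - 1"
    using assms by (subst card_image) (auto simp: inj_on_def)
  ultimately show ?thesis
    using assms by (simp add: card_Un_disjoint Int_Un_distrib2 image_iff)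
qed

lemma card_IO_M:
  assumes "n \<ge> 3"
  shows "card (IO (M n)) = 2 ^ (n - 2) + 3 * n - 4 + (if n \<le> 4 then n - 2 else 0)"
  using card_shapes[OF assms] by (simp add: IO_M_eq card_image[OF op_of_inj])

lemma card_IO_classes_M:
  assumes n: "n \<ge> 3"
  shows "card (IO_classes (M n)) = n + 4 + (if n \<le> 4 then 1 else 0)"
proof -
  let ?r = "IO_iso (M n)"
  have "IO_classes (M n) = (\<lambda>c. ?r `` {op_of n c}) ` shapes n"
    by (auto simp: IO_classes_def quotient_def IO_M_eq)
  also have "card \<dots> = card (canon ` shapes n)"
  proof (rule card_image_eq_card_image)
    fix c d assume cd: "c \<in> shapes n" "d \<in> shapes n"
    then have "op_of n c \<in> IO (M n)" "op_of n d \<in> IO (M n)" by (auto simp: IO_M_eq)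
    then show "?r `` {op_of n c} = ?r `` {op_of n d} \<longleftrightarrow> canon c = canon d"
      using eq_equiv_class_iff[OF equiv_IO_iso[OF lattice_M]] IO_iso_op_of_iff_canon[OF cd] by metis
  qed
  finally show ?thesis using card_canon_shapes[OF n] by simp
qed

theorem theorem3p15:
  shows "(card (IO (M 3)) = 8 \<and> card (IO_classes (M 3)) = 8) \<and>
         (card (IO (M 4)) = 14 \<and> card (IO_classes (M 4)) = 9) \<and>
         (\<forall>n::nat. n \<ge> 5 \<longrightarrow>
            card (IO (M n)) = 2 ^ (n - 2) + 3 * n - 4 \<and> card (IO_classes (M n)) = n + 4)"
  by (simp add: card_IO_M card_IO_classes_M)

end
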